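(* Let $n$ be the number of robots. For any integer $f$ with $2\le f\le n-1$ and any real $\alpha$ with $0<\alpha<1$, there are two target functions $\xi_{(\alpha,n)}$ and $\xi'_{(\alpha,n)}$ such that (1) $\alpha(\xi_{(\alpha,n)})=\alpha(\xi'_{(\alpha,n)})=\alpha$, (2) both $\Phi=\{\xi_{(\alpha,n)}\}$ and $\Phi'=\{\xi'_{(\alpha,n)}\}$ are compatible with respect to the fault-tolerant $(n,f)$-convergence problem FC($f$), but (3) $\Phi\cup\Phi'$ is not compatible with respect to the fault-tolerant $(n,f)$-convergence problem FC($f$).
   Context: Robot model. The number $n$ of robots is given. Robots $r_1,\dots,r_n$ are points in the plane $\mathbb{R}^2$, which carries a fixed right-handed global coordinate system $Z_0$. Time is discrete, $t=0,1,2,\dots$; $\mathbf{x}_t(r_i)$ is the position of $r_i$ at time $t$ in $Z_0$, and the configuration at $t$ is the multiset $P_t=\{\mathbf{x}_t(r_i):1\le i\le n\}$. Robot $r_i$ has a local coordinate system $Z_i$, right-handed, with its own unit length and axis directions, whose origin is always the current position of $r_i$; $\gamma_i$ denotes the coordinate transformation from $Z_i$ to $Z_0$ (so $\gamma_i((0,0))=\mathbf{x}_t(r_i)$ at time $t$). A target function $\phi$ assigns to every multiset $P$ of $n$ points of $\mathbb{R}^2$ an element of $\mathbb{R}^2\cup\{\bot\}$, with $\phi(P)=\bot$ if and only if $(0,0)\notin P$. Each robot $r_i$ is assigned a target function $\phi_i$. The scheduler is semi-synchronous: at each time $t$ an arbitrary subset of robots is activated; if a non-crashed $r_i$ is activated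 at $t$ then $\mathbf{x}_{t+1}(r_i)=\gamma_i(\phi_i(\gamma_i^{-1}(P_t)))$, otherwise $\mathbf{x}_{t+1}(r_i)=\mathbf{x}_t(r_i)$. The schedule is fair: every robot is activated infinitely often. A faulty robot may crash at an arbitrary time, after which it never moves again; crashed robots cannot be distinguished from other robots. Scale. $CH(P)$ is the convex hull of $P$, $g(P)=\frac1n\sum_{\mathbf{x}\in P}\mathbf{x}$ (with multiplicity), and $d*CH(P)=\{d\mathbf{x}+(1-d)g(P):\mathbf{x}\in CH(P)\}$ for $d\ge0$. $\alpha(\phi,P)$ is the smallest $d\ge 0$ with $\phi(P)\in d*CH(P)$ (and $0$ if $\phi(P)=\bot$). The scale of $\phi$ is $\alpha(\phi)=\sup_{P\in(\mathbb{R}^2)^n}\alpha(\phi,P)$. Compatibility. A non-empty set $\Phi$ of target functions is compatible with respect to the fault-tolerant $(n,f)$-convergence problem FC($f$) if, for $n$ robots, for every assignment of target functions from $\Phi$ to the robots (different robots may get different ones), every choice of local coordinate systems, every initial configuration, every fair schedule and every pattern of crashes in which at most $f$ robots are faulty, all non-faulty robots converge to one common point as $t\to\infty$.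
   Formalization: The case n=3, f=2 is excluded (n≥4 is assumed) because the claim is false there: with at most one crash, scales below 1 force convergence, and with two crashes the lone survivor uses only one target function, so the union is compatible. *)

theory Defs
  imports "HOL-Analysis.Analysis" "HOL-Library.Extended_Nat"
begin

section \<open>Target functions and their scale\<close>

text \<open>
  The plane with its right-handed coordinate system is the type \<^typ>\<open>complex\<close>; \<^const>\<open>None\<close> is the
  undefined value. Only the values of a target function on multisets of size \<open>n\<close> matter.
\<close>

type_synonym target = "complex multiset \<Rightarrow> complex option"

definition target_function :: "nat \<Rightarrow> target \<Rightarrow> bool" where
  "target_function n \<phi> \<longleftrightarrow> (\<forall>P. size P = n \<longrightarrow> (\<phi> P = None \<longleftrightarrow> 0 \<notin># P))"

definition centroid :: "complex multiset \<Rightarrow> complex" where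
  "centroid P = sum_mset P /\<^sub>R real (size P)"

definition scaled_hull :: "real \<Rightarrow> complex multiset \<Rightarrow> complex set" where
  "scaled_hull d P = (\<lambda>x. d *\<^sub>R x + (1 - d) *\<^sub>R centroid P) ` (convex hull (set_mset P))"

text \<open>
  The infimum is a minimum whenever some \<open>d\<close> is admissible (lemma \<open>scale_at_attained\<close>), and it is
  \<open>\<infinity>\<close> if no \<open>d\<close> is, which is possible for collinear \<open>P\<close>.
\<close>

definition scale_at :: "target \<Rightarrow> complex multiset \<Rightarrow> ereal" where
  "scale_at \<phi> P =
     (case \<phi> P of
        None \<Rightarrow> 0
      | Some y \<Rightarrow> Inf {ereal d | d. 0 \<le> d \<and> y \<in> scaled_hull d P})"

definition target_scale :: "nat \<Rightarrow> target \<Rightarrow> ereal" where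
  "target_scale n \<phi> = (SUP P\<in>{P. size P = n}. scale_at \<phi> P)"

section \<open>Executions\<close>

text \<open>
  A right-handed local coordinate system with origin \<open>c\<close> is given by a complex number \<open>a \<noteq> 0\<close>:
  its modulus is the unit length and its argument the direction of the first axis.
  \<open>to_global c a\<close> is the transformation \<open>\<gamma>\<close> and \<open>to_local c a\<close> its inverse.
\<close>

definition to_global :: "complex \<Rightarrow> complex \<Rightarrow> complex \<Rightarrow> complex" where
  "to_global c a z = c + a * z"

definition to_local :: "complex \<Rightarrow> complex \<Rightarrow> complex \<Rightarrow> complex" where
  "to_local c a w = (w - c) / a"

lemma to_global_to_local: "a \<noteq> 0 \<Longrightarrow> to_global c a (to_local c a w) = w"
  and to_local_to_global: "a \<noteq> 0 \<Longrightarrow> to_local c a (to_global c a z) = z"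
  by (simp_all add: to_global_def to_local_def)

text \<open>Robots are numbered \<open>0, \<dots>, n - 1\<close>.\<close>

definition configuration :: "nat \<Rightarrow> (nat \<Rightarrow> complex) \<Rightarrow> complex multiset" where
  "configuration n p = image_mset p (mset_set {..<n})"

text \<open>
  \<open>A t\<close> is the set of robots activated at time \<open>t\<close>. Robot \<open>i\<close> crashes at time \<open>crash i\<close>, that is,
  it stays at \<open>x (crash i) i\<close> from then on; it is non-faulty iff \<open>crash i = \<infinity>\<close>.
  The value \<open>None\<close> cannot occur below, since the observer's own position is \<open>0\<close> in its frame.
\<close>

definition fair :: "nat \<Rightarrow> (nat \<Rightarrow> nat set) \<Rightarrow> bool" where
  "fair n A \<longleftrightarrow> (\<forall>t. A t \<subseteq> {..<n}) \<and> (\<forall>i<n. \<exists>\<^sub>\<infinity>t. i \<in> A t)"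

definition next_position ::
  "nat \<Rightarrow> target \<Rightarrow> complex \<Rightarrow> (nat \<Rightarrow> complex) \<Rightarrow> nat \<Rightarrow> complex" where
  "next_position n \<phi> a p i =
     to_global (p i) a (the (\<phi> (image_mset (to_local (p i) a) (configuration n p))))"

definition execution ::
  "nat \<Rightarrow> (nat \<Rightarrow> target) \<Rightarrow> (nat \<Rightarrow> complex) \<Rightarrow> (nat \<Rightarrow> nat set) \<Rightarrow> (nat \<Rightarrow> enat)
    \<Rightarrow> (nat \<Rightarrow> nat \<Rightarrow> complex) \<Rightarrow> bool" where
  "execution n \<phi> a A crash x \<longleftrightarrow>
     (\<forall>t. \<forall>i<n. x (Suc t) i =
        (if i \<in> A t \<and> \<not> crash i \<le> enat t then next_position n (\<phi> i) (a i) (x t) i else x t i))"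

definition faulty :: "nat \<Rightarrow> (nat \<Rightarrow> enat) \<Rightarrow> nat set" where
  "faulty n crash = {i. i < n \<and> crash i \<noteq> \<infinity>}"

section \<open>Compatibility with fault-tolerant convergence\<close>

definition FC_compatible :: "nat \<Rightarrow> nat \<Rightarrow> target set \<Rightarrow> bool" where
  "FC_compatible n f \<Phi> \<longleftrightarrow>
     \<Phi> \<noteq> {} \<and> (\<forall>\<phi>\<in>\<Phi>. target_function n \<phi>) \<and>
     (\<forall>\<phi> a A crash x.
        (\<forall>i<n. \<phi> i \<in> \<Phi>) \<and> (\<forall>i<n. a i \<noteq> 0) \<and> fair n A \<and> card (faulty n crash) \<le> f \<and>
        execution n \<phi> a A crash x \<longrightarrow>
        (\<exists>L. \<forall>i<n. i \<notin> faulty n crash \<longrightarrow> (\<lambda>t. x t i) \<longlonglongrightarrow> L))"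

section \<open>The scale is a minimum\<close>

lemma scale_at_attained:
  assumes "\<phi> P = Some y" and "0 \<le> d" and "y \<in> scaled_hull d P"
  shows "\<exists>e. 0 \<le> e \<and> y \<in> scaled_hull e P \<and> scale_at \<phi> P = ereal e"
proof -
  let ?H = "convex hull (set_mset P)"
  let ?F = "\<lambda>z::real \<times> complex. fst z *\<^sub>R snd z + (1 - fst z) *\<^sub>R centroid P"
  let ?K = "({0..d} \<times> ?H) \<inter> ?F -` {y}"
  have "compact ?H"
    by (intro compact_convex_hull finite_imp_compact) simp
  then have cK: "compact ({0..d} \<times> ?H)"
    by (intro compact_Times) auto
  have "continuous_on ({0..d} \<times> ?H) ?F"
    by (intro continuous_intros)
  then have "closed ?K"
    using cK by (intro continuous_closed_preimage) (auto simp: compact_imp_closed)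
  then have "compact (?K \<inter> ({0..d} \<times> ?H))"
    using cK by (rule closed_Int_compact)
  moreover have "?K \<inter> ({0..d} \<times> ?H) = ?K"
    by blast
  ultimately have "compact ?K"
    by (simp only:)
  then have cf: "compact (fst ` ?K)"
    by (intro compact_continuous_image continuous_intros)
  obtain h where "h \<in> ?H" "y = d *\<^sub>R h + (1 - d) *\<^sub>R centroid P"
    using assms(3) by (auto simp: scaled_hull_def)
  then have "(d, h) \<in> ?K"
    using assms(2) by auto
  then have ne: "fst ` ?K \<noteq> {}"
    by blast
  obtain e where e: "e \<in> fst ` ?K" and min: "\<And>b. b \<in> fst ` ?K \<Longrightarrow> e \<le> b"
    using compact_attains_inf[OF cf ne] by blast
  have e1: "0 \<le> e" "e \<le> d" "y \<in> scaled_hull e P"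
    using e by (auto simp: scaled_hull_def)
  have least: "e \<le> b" if b: "0 \<le> b" "y \<in> scaled_hull b P" for b
  proof (cases "b \<le> d")
    case True
    obtain k where "k \<in> ?H" "y = b *\<^sub>R k + (1 - b) *\<^sub>R centroid P"
      using b(2) by (auto simp: scaled_hull_def)
    then have "(b, k) \<in> ?K"
      using b(1) True by auto
    then show ?thesis
      using min by force
  qed (use e1 in simp)
  have "Inf {ereal b | b. 0 \<le> b \<and> y \<in> scaled_hull b P} = ereal e"
    by (rule antisym) (use e1 least in \<open>auto intro!: Inf_lower Inf_greatest\<close>)
  then show ?thesis
    using e1 assms(1) by (auto simp: scale_at_def)
qed

section \<open>Three robots\<close>

text \<open>
  For \<open>n = 3\<close> and \<open>f = 2\<close> compatibility of \<open>{\<xi>}\<close> and of \<open>{\<xi>'}\<close> implies compatibility of \<open>{\<xi>, \<xi>'}\<close>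
  when the scales are below 1 (\<open>three_robots_compatible\<close>): with at most one faulty robot, scales
  below 1 already force convergence, and with two faulty robots a single robot survives, whose
  limit behaviour involves one target function only. Hence incompatible unions require \<open>n \<ge> 4\<close>.
\<close>

lemma sum_mset_Re_le:
  fixes P :: "complex multiset"
  assumes "\<forall>p\<in>#P. b + Re (w * p) \<le> M"
  shows "real (size P) * b + Re (w * sum_mset P) \<le> real (size P) * M"
  using assms
proof (induction P)
  case (add p P)
  then have "real (size P) * b + Re (w * sum_mset P) \<le> real (size P) * M" "b + Re (w * p) \<le> M"
    by auto
  then show ?case
    unfolding size_add_mset sum_mset.add_mset of_nat_Suc distrib_right distrib_left plus_complex.sel
    by linarith
qed simp

lemma target_width:
  assumes sc: "target_scale n \<phi> \<le> ereal \<alpha>" and "\<alpha> < 1" and sz: "size P = n" and y: "\<phi> P = Some y"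
    and M: "\<forall>p\<in>#P. b + Re (w * p) \<le> M" and q: "q \<in># P"
  shows "b + Re (w * y) \<le> M - (1 - \<alpha>) / real n * (M - (b + Re (w * q)))"
proof -
  let ?h = "\<lambda>z. b + Re (w * z)"
  have "scale_at \<phi> P \<le> target_scale n \<phi>"
    unfolding target_scale_def using sz by (intro SUP_upper) auto
  with sc have le: "scale_at \<phi> P \<le> ereal \<alpha>"
    by order
  have "\<exists>d. 0 \<le> d \<and> y \<in> scaled_hull d P"
  proof (rule ccontr)
    assume "\<not> ?thesis"
    then have "{ereal d | d. 0 \<le> d \<and> y \<in> scaled_hull d P} = {}"
      by blast
    then have "scale_at \<phi> P = Inf {}"
      using y unfolding scale_at_def by (simp only: option.case)
    then show False
      using le by (simp add: top_ereal_def)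
  qed
  then obtain e where e: "0 \<le> e" "y \<in> scaled_hull e P" "scale_at \<phi> P = ereal e"
    using scale_at_attained[of \<phi> P y] y by blast
  then have e\<alpha>: "e \<le> \<alpha>"
    using le by simp
  obtain x where x: "x \<in> convex hull (set_mset P)"
    and yx: "y = e *\<^sub>R x + (1 - e) *\<^sub>R centroid P"
    using e(2) by (auto simp: scaled_hull_def)
  have "convex {z. inner (cnj w) z \<le> M - b}"
    by (rule convex_halfspace_le)
  moreover have inn: "inner (cnj w) z = Re (w * z)" for z
    by (simp add: inner_complex_def)
  ultimately have "convex {z. Re (w * z) \<le> M - b}"
    by simp
  then have "convex hull (set_mset P) \<subseteq> {z. Re (w * z) \<le> M - b}"
    by (rule hull_minimal[rotated]) (use M in force)
  then have hx: "?h x \<le> M"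
    using x by auto
  obtain R where R: "P = add_mset q R"
    using q by (metis mset_add)
  then have n: "real n = real (size R) + 1"
    using sz by auto
  have "real (size R) * b + Re (w * sum_mset R) \<le> real (size R) * M"
    using M R by (intro sum_mset_Re_le) auto
  moreover have "real n * ?h (centroid P) = real n * b + Re (w * sum_mset P)"
    using n sz by (simp add: centroid_def distrib_left)
  moreover have "Re (w * sum_mset P) = Re (w * q) + Re (w * sum_mset R)"
    unfolding R sum_mset.add_mset distrib_left plus_complex.sel ..
  ultimately have "real n * ?h (centroid P) \<le> real n * M - (M - ?h q)"
    unfolding n by (simp add: algebra_simps)
  then have hg: "?h (centroid P) \<le> M - (M - ?h q) / real n"
    using n by (simp add: field_simps)
  have "?h y = e * ?h x + (1 - e) * ?h (centroid P)"
    unfolding yx by (simp add: algebra_simps)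
  also have "\<dots> \<le> e * M + (1 - e) * (M - (M - ?h q) / real n)"
    using hx hg e e\<alpha> \<open>\<alpha> < 1\<close> by (intro add_mono mult_left_mono) auto
  also have "\<dots> = M - (1 - e) * ((M - ?h q) / real n)"
    by (simp add: algebra_simps)
  also have "\<dots> \<le> M - (1 - \<alpha>) * ((M - ?h q) / real n)"
    using M q e\<alpha> by (intro diff_left_mono mult_right_mono) auto
  finally show ?thesis
    by simp
qed

lemma step_width:
  assumes "target_scale n \<phi> \<le> ereal \<alpha>" and "\<alpha> < 1" and "target_function n \<phi>" and "a \<noteq> 0"
    and "i < n" and M: "\<forall>j<n. Re (v * p j) \<le> M" and "k < n"
  shows "Re (v * next_position n \<phi> a p i) \<le> M - (1 - \<alpha>) / real n * (M - Re (v * p k))"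
proof -
  let ?P = "image_mset (to_local (p i) a) (configuration n p)"
  have sz: "size ?P = n"
    by (simp add: configuration_def)
  have mem: "to_local (p i) a (p j) \<in># ?P" if "j < n" for j
    using that by (auto simp: configuration_def)
  have "0 \<in># ?P"
    using mem[OF \<open>i < n\<close>] by (simp add: to_local_def)
  then obtain y where y: "\<phi> ?P = Some y"
    using assms(3) sz unfolding target_function_def by fastforce
  have h: "Re (v * p i) + Re (v * a * z) = Re (v * to_global (p i) a z)" for z
    by (simp add: to_global_def algebra_simps)
  have "Re (v * p i) + Re (v * a * y)
      \<le> M - (1 - \<alpha>) / real n * (M - (Re (v * p i) + Re (v * a * to_local (p i) a (p k))))"
  proof (rule target_width[OF assms(1,2) sz y])
    show "\<forall>q\<in>#?P. Re (v * p i) + Re (v * a * q) \<le> M"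
      using M unfolding h by (auto simp: configuration_def to_global_to_local[OF \<open>a \<noteq> 0\<close>])
    show "to_local (p i) a (p k) \<in># ?P"
      using mem[OF \<open>k < n\<close>] .
  qed
  then show ?thesis
    unfolding h to_global_to_local[OF \<open>a \<noteq> 0\<close>] next_position_def y option.sel .
qed

lemma ex_stage:
  assumes "\<forall>i<(n::nat). \<exists>T::nat. \<forall>t\<ge>T. Q i t"
  shows "\<exists>T. \<forall>i<n. \<forall>t\<ge>T. Q i t"
  using assms
proof (induction n)
  case (Suc n)
  then obtain T T' where "\<forall>i<n. \<forall>t\<ge>T. Q i t" "\<forall>t\<ge>T'. Q n t"
    by (metis less_Suc_eq)
  then have "\<forall>i<Suc n. \<forall>t\<ge>max T T'. Q i t"
    by (auto simp: less_Suc_eq)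
  then show ?case ..
qed simp

text \<open>One-sided shrinking: eventually only robots in \<open>F\<close> can be extreme in a given direction.\<close>

lemma extreme_in_F:
  fixes f :: "nat \<Rightarrow> nat \<Rightarrow> real"
  assumes c: "c > 0"
    and step: "\<And>t i. i < n \<Longrightarrow> f (Suc t) i = f t i \<or> f (Suc t) i \<le> M t - c"
    and move: "\<And>i. i < n \<Longrightarrow> i \<notin> F \<Longrightarrow> \<exists>\<^sub>\<infinity>t. f (Suc t) i \<le> M t - c"
    and M: "M \<longlonglongrightarrow> L" "\<And>t. M t \<ge> L" "\<And>t. \<exists>i<n. f t i = M t"
  shows "\<exists>T. \<forall>t\<ge>T. \<exists>i\<in>F. i < n \<and> f t i \<ge> L"
proof -
  have "\<forall>\<^sub>F t in sequentially. M t < L + c"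
    using M(1) c by (intro order_tendstoD(2)) auto
  then obtain T0 where T0: "\<And>t. t \<ge> T0 \<Longrightarrow> M t < L + c"
    by (auto simp: eventually_sequentially)
  have "\<exists>T. \<forall>t\<ge>T. i \<notin> F \<longrightarrow> f t i < L" if "i < n" for i
  proof (cases "i \<in> F")
    case False
    obtain s where s: "s \<ge> T0" "f (Suc s) i \<le> M s - c"
      using move[OF \<open>i < n\<close> False] unfolding INFM_nat_le by blast
    have "f t i < L" if "t \<ge> Suc s" for t
      using that
    proof (induction t rule: dec_induct)
      case base
      show ?case
        using s T0[of s] by linarith
    next
      case (step t)
      then show ?case
        using assms(2)[OF \<open>i < n\<close>, of t] T0[of t] s by force
    qed
    then show ?thesis
      by blast
  qed auto
  then obtain T where T: "\<forall>i<n. \<forall>t\<ge>T. i \<notin> F \<longrightarrow> f t i < L"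
    using ex_stage[of n "\<lambda>i t. i \<notin> F \<longrightarrow> f t i < L"] by blast
  have "\<exists>i\<in>F. i < n \<and> f t i \<ge> L" if "t \<ge> T" for t
    using M(2,3)[of t] T that by (metis not_less)
  then show ?thesis
    by blast
qed

lemma shrink_converge:
  fixes f :: "nat \<Rightarrow> nat \<Rightarrow> real"
  assumes c: "c > 0" "c \<le> 1" and n: "n > 0"
    and up: "\<And>t i m. i < n \<Longrightarrow> act t i \<Longrightarrow> \<forall>j<n. f t j \<le> m \<Longrightarrow>
               \<forall>k<n. f (Suc t) i \<le> m - c * (m - f t k)"
    and dn: "\<And>t i m. i < n \<Longrightarrow> act t i \<Longrightarrow> \<forall>j<n. m \<le> f t j \<Longrightarrow>
               \<forall>k<n. f (Suc t) i \<ge> m + c * (f t k - m)"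
    and stay: "\<And>t i. i < n \<Longrightarrow> \<not> act t i \<Longrightarrow> f (Suc t) i = f t i"
    and inf: "\<And>i. i < n \<Longrightarrow> i \<notin> F \<Longrightarrow> \<exists>\<^sub>\<infinity>t. act t i"
    and F: "finite F" "card F \<le> 1"
  shows "\<exists>L. \<forall>i<n. (\<lambda>t. f t i) \<longlonglongrightarrow> L"
proof -
  define M where "M t = Max (f t ` {..<n})" for t
  define m where "m t = Min (f t ` {..<n})" for t
  have ne: "f t ` {..<n} \<noteq> {}" "finite (f t ` {..<n})" for t
    using n by auto
  have Mge: "f t i \<le> M t" and mle: "m t \<le> f t i" if "i < n" for t i
    using that by (auto simp: M_def m_def)
  have Mex: "\<exists>i<n. f t i = M t" and mex: "\<exists>i<n. f t i = m t" for t
    using Max_in[OF ne(2,1), of t] Min_in[OF ne(2,1), of t] by (auto simp: M_def m_def)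
  have mM: "m t \<le> M t" for t
    using Mge[of 0] mle[of 0] n order_trans by blast
  have up': "f (Suc t) i \<le> M t - c * (M t - m t)" if "i < n" "act t i" for t i
    using up[OF that, of "M t"] mex[of t] Mge by auto
  have dn': "f (Suc t) i \<ge> m t + c * (M t - m t)" if "i < n" "act t i" for t i
    using dn[OF that, of "m t"] Mex[of t] mle by auto
  have pos: "c * (M t - m t) \<ge> 0" for t
    using c mM[of t] by simp
  have bnd: "m t \<le> f (Suc t) i \<and> f (Suc t) i \<le> M t" if "i < n" for t i
    using up'[OF that, of t] dn'[OF that, of t] stay[OF that, of t] pos[of t] Mge[OF that, of t]
      mle[OF that, of t] by (cases "act t i") auto
  have "decseq M"
    unfolding decseq_Suc_iff using Mex bnd by metis
  have "incseq m"
    unfolding incseq_Suc_iff using mex bnd by metis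
  have "m 0 \<le> M t" "m t \<le> M 0" for t
    using mM[of t] \<open>incseq m\<close> \<open>decseq M\<close> by (metis incseqD decseqD le0 order_trans)+
  then obtain LM Lm where LM: "M \<longlonglongrightarrow> LM" "\<And>t. LM \<le> M t" and Lm: "m \<longlonglongrightarrow> Lm" "\<And>t. m t \<le> Lm"
    using decseq_convergent[OF \<open>decseq M\<close>] incseq_convergent[OF \<open>incseq m\<close>] by metis
  have le: "Lm \<le> LM"
    using LIMSEQ_le[OF Lm(1) LM(1)] mM by blast
  have "Lm = LM"
  proof (rule ccontr)
    assume "Lm \<noteq> LM"
    then have W: "c * (LM - Lm) > 0"
      using le c by simp
    have w: "c * (LM - Lm) \<le> c * (M t - m t)" for t
      using LM(2)[of t] Lm(2)[of t] c by (intro mult_left_mono) auto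
    have up'': "f (Suc t) i \<le> M t - c * (LM - Lm)"
      and dn'': "- f (Suc t) i \<le> - m t - c * (LM - Lm)" if "i < n" "act t i" for t i
      using up'[OF that] dn'[OF that] w[of t] by linarith+
    have "\<exists>T. \<forall>t\<ge>T. \<exists>i\<in>F. i < n \<and> f t i \<ge> LM"
    proof (rule extreme_in_F[OF W _ _ LM(1)])
      show "f (Suc t) i = f t i \<or> f (Suc t) i \<le> M t - c * (LM - Lm)" if "i < n" for t i
        using up''[OF that, of t] stay[OF that, of t] by blast
      show "\<exists>\<^sub>\<infinity>t. f (Suc t) i \<le> M t - c * (LM - Lm)" if "i < n" "i \<notin> F" for i
        by (rule INFM_mono[OF inf[OF that] up''[OF that(1)]])
    qed (use LM(2) Mex in auto)
    moreover have "\<exists>T. \<forall>t\<ge>T. \<exists>i\<in>F. i < n \<and> - f t i \<ge> - Lm"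
    proof (rule extreme_in_F[where f = "\<lambda>t i. - f t i" and M = "\<lambda>t. - m t", OF W])
      show "- f (Suc t) i = - f t i \<or> - f (Suc t) i \<le> - m t - c * (LM - Lm)" if "i < n" for t i
        using dn''[OF that, of t] stay[OF that, of t] by fastforce
      show "\<exists>\<^sub>\<infinity>t. - f (Suc t) i \<le> - m t - c * (LM - Lm)" if "i < n" "i \<notin> F" for i
        by (rule INFM_mono[OF inf[OF that] dn''[OF that(1)]])
      show "(\<lambda>t. - m t) \<longlonglongrightarrow> - Lm"
        using Lm(1) by (rule tendsto_minus)
    qed (use Lm(2) mex in auto)
    ultimately obtain T T' where
      T: "\<forall>t\<ge>T. \<exists>i\<in>F. i < n \<and> f t i \<ge> LM" and T': "\<forall>t\<ge>T'. \<exists>i\<in>F. i < n \<and> - f t i \<ge> - Lm"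
      by blast
    let ?t = "max T T'"
    obtain i where i: "i \<in> F" "f ?t i \<ge> LM"
      using T by (meson max.cobounded1)
    obtain j where j: "j \<in> F" "- f ?t j \<ge> - Lm"
      using T' by (meson max.cobounded2)
    have "i = j"
      using i j F by (metis One_nat_def card_le_Suc0_iff_eq)
    then show False
      using i j le \<open>Lm \<noteq> LM\<close> by simp
  qed
  have "(\<lambda>t. f t i) \<longlonglongrightarrow> LM" if "i < n" for i
    using Lm(1) LM(1) unfolding \<open>Lm = LM\<close>
    by (rule tendsto_sandwich[rotated 2]) (use Mge[OF that] mle[OF that] in auto)
  then show ?thesis
    by blast
qed

lemma one_fault_converge:
  assumes sc: "\<And>i. i < n \<Longrightarrow> target_scale n (\<phi> i) \<le> ereal \<alpha>" and \<alpha>: "0 \<le> \<alpha>" "\<alpha> < 1"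
    and tf: "\<And>i. i < n \<Longrightarrow> target_function n (\<phi> i)" and a: "\<And>i. i < n \<Longrightarrow> a i \<noteq> 0" and "n > 0"
    and fair: "fair n A" and ex: "execution n \<phi> a A crash x" and F: "card (faulty n crash) \<le> 1"
  shows "\<exists>L. \<forall>i<n. (\<lambda>t. x t i) \<longlonglongrightarrow> L"
proof -
  define act where "act t i \<longleftrightarrow> i \<in> A t \<and> \<not> crash i \<le> enat t" for t i
  have nxt: "x (Suc t) i = (if act t i then next_position n (\<phi> i) (a i) (x t) i else x t i)"
    if "i < n" for t i
    using ex that by (simp add: execution_def act_def)
  have inf: "\<exists>\<^sub>\<infinity>t. act t i" if "i < n" "i \<notin> faulty n crash" for i
    using fair that by (simp add: fair_def act_def faulty_def)
  have fin: "finite (faulty n crash)"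
    by (simp add: faulty_def)
  have c: "(1 - \<alpha>) / real n > 0" "(1 - \<alpha>) / real n \<le> 1"
    using \<alpha> \<open>n > 0\<close> by (auto simp: field_simps)
  have sw: "Re (v * x (Suc t) i) \<le> m - (1 - \<alpha>) / real n * (m - Re (v * x t k))"
    if "i < n" "act t i" "\<forall>j<n. Re (v * x t j) \<le> m" "k < n" for v t i m k
    using step_width[OF sc[OF that(1)] \<alpha>(2) tf[OF that(1)] a[OF that(1)] that(1,3,4)]
      nxt[OF that(1), of t] that(2) by simp
  have "\<exists>L. \<forall>i<n. (\<lambda>t. Re (v * x t i)) \<longlonglongrightarrow> L" for v
  proof (rule shrink_converge[OF c \<open>n > 0\<close>, where act = act, OF _ _ _ inf fin F])
    fix t i m assume i: "i < n" "act t i"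
    show "\<forall>k<n. Re (v * x (Suc t) i) \<le> m - (1 - \<alpha>) / real n * (m - Re (v * x t k))"
      if "\<forall>j<n. Re (v * x t j) \<le> m"
      using sw[OF i that] by blast
    show "\<forall>k<n. Re (v * x (Suc t) i) \<ge> m + (1 - \<alpha>) / real n * (Re (v * x t k) - m)"
      if "\<forall>j<n. Re (v * x t j) \<ge> m"
      using sw[OF i, of "- v" "- m"] that by (auto simp: algebra_simps)
  qed (use nxt in simp_all)
  from this[of 1] this[of "- \<i>"] obtain X Y where
    "\<forall>i<n. (\<lambda>t. Re (x t i)) \<longlonglongrightarrow> X" "\<forall>i<n. (\<lambda>t. Im (x t i)) \<longlonglongrightarrow> Y"
    by auto
  then have "\<forall>i<n. (\<lambda>t. x t i) \<longlonglongrightarrow> Complex X Y"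
    by (simp add: tendsto_complex_iff)
  then show ?thesis ..
qed

lemma FC_compatibleD:
  assumes "FC_compatible n f \<Phi>"
    and "\<And>i. i < n \<Longrightarrow> \<phi> i \<in> \<Phi>" and "\<And>i. i < n \<Longrightarrow> a i \<noteq> 0" and "fair n A"
    and "card (faulty n crash) \<le> f" and "execution n \<phi> a A crash x"
  shows "\<exists>L. \<forall>i<n. i \<notin> faulty n crash \<longrightarrow> (\<lambda>t. x t i) \<longlonglongrightarrow> L"
  using assms(1)[unfolded FC_compatible_def, THEN conjunct2, THEN conjunct2, rule_format,
      of \<phi> a A crash x] assms(2-6)
  by blast

text \<open>If all but one robot are faulty, the survivor's limit is governed by its own target function.\<close>

lemma single_survivor_converge:
  assumes comp: "FC_compatible n (n - 1) {\<phi> k}" and a: "\<And>i. i < n \<Longrightarrow> a i \<noteq> 0"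
    and fair: "fair n A" and ex: "execution n \<phi> a A crash x"
    and k: "k < n" and F: "faulty n crash = {..<n} - {k}"
  shows "\<exists>L. (\<lambda>t. x t k) \<longlonglongrightarrow> L"
proof -
  have "\<exists>T. \<forall>i<n. \<forall>t\<ge>T. i \<noteq> k \<longrightarrow> crash i \<le> enat t"
  proof (rule ex_stage, intro allI impI)
    fix i assume "i < n"
    show "\<exists>T. \<forall>t\<ge>T. i \<noteq> k \<longrightarrow> crash i \<le> enat t"
    proof (cases "i = k")
      case False
      then have "i \<in> faulty n crash"
        using F \<open>i < n\<close> by blast
      then obtain T where "crash i = enat T"
        by (auto simp: faulty_def)
      then show ?thesis
        by auto
    qed auto
  qed
  then obtain T where T0: "\<forall>i<n. \<forall>t\<ge>T. i \<noteq> k \<longrightarrow> crash i \<le> enat t" ..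
  have T: "crash i \<le> enat t" if "i < n" "t \<ge> T" "i \<noteq> k" for i t
    using T0 that by simp
  have "k \<notin> faulty n crash"
    unfolding F by simp
  then have ck: "crash k = \<infinity>"
    using k by (simp add: faulty_def)
  define crash' where "crash' i = (if i = k then \<infinity> else enat 0)" for i
  have F': "faulty n crash' = {..<n} - {k}"
    by (auto simp: faulty_def crash'_def)
  have "execution n (\<lambda>_. \<phi> k) a (\<lambda>t. A (t + T)) crash' (\<lambda>t. x (t + T))"
    unfolding execution_def
  proof (intro allI impI)
    fix t i assume "i < n"
    then have "x (Suc (t + T)) i = (if i \<in> A (t + T) \<and> \<not> crash i \<le> enat (t + T)
        then next_position n (\<phi> i) (a i) (x (t + T)) i else x (t + T) i)"
      using ex by (simp add: execution_def)
    then show "x (Suc t + T) i = (if i \<in> A (t + T) \<and> \<not> crash' i \<le> enat t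
        then next_position n (\<phi> k) (a i) (x (t + T)) i else x (t + T) i)"
      using T[OF \<open>i < n\<close>, of "t + T"] ck by (cases "i = k") (simp_all add: crash'_def)
  qed
  moreover have "fair n (\<lambda>t. A (t + T))"
    unfolding fair_def
  proof (intro conjI allI impI)
    fix i assume "i < n"
    have "\<exists>\<^sub>\<infinity>t. i \<in> A t"
      using fair \<open>i < n\<close> by (simp add: fair_def)
    show "\<exists>\<^sub>\<infinity>t. i \<in> A (t + T)"
      unfolding INFM_nat_le
    proof
      fix m
      obtain s where "m + T \<le> s" "i \<in> A s"
        using \<open>\<exists>\<^sub>\<infinity>t. i \<in> A t\<close> unfolding INFM_nat_le by blast
      then have "m \<le> s - T \<and> i \<in> A (s - T + T)"
        by simp
      then show "\<exists>t\<ge>m. i \<in> A (t + T)" ..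
    qed
  qed (use fair in \<open>simp add: fair_def\<close>)
  moreover have "card (faulty n crash') \<le> n - 1"
    unfolding F' using k by simp
  ultimately have "\<exists>L. \<forall>i<n. i \<notin> faulty n crash' \<longrightarrow> (\<lambda>t. x (t + T) i) \<longlonglongrightarrow> L"
    by - (rule FC_compatibleD[OF comp, where \<phi> = "\<lambda>_. \<phi> k" and a = a and A = "\<lambda>t. A (t + T)"],
        simp_all add: a)
  then show ?thesis
    using k by (auto simp: F' intro: LIMSEQ_offset)
qed

theorem three_robots_compatible:
  assumes "\<alpha> < 1" and "target_scale 3 \<xi> = ereal \<alpha>" and "target_scale 3 \<xi>' = ereal \<alpha>"
    and "FC_compatible 3 2 {\<xi>}" and "FC_compatible 3 2 {\<xi>'}"
  shows "FC_compatible 3 2 ({\<xi>} \<union> {\<xi>'})"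
proof -
  have "\<exists>L. \<forall>i<3. i \<notin> faulty 3 crash \<longrightarrow> (\<lambda>t. x t i) \<longlonglongrightarrow> L"
    if \<phi>: "\<forall>i<3. \<phi> i \<in> {\<xi>} \<union> {\<xi>'}" and a: "\<forall>i<3. a i \<noteq> 0" and fair: "fair 3 A"
      and F: "card (faulty 3 crash) \<le> 2" and ex: "execution 3 \<phi> a A crash x" for \<phi> a A crash x
  proof (cases "card (faulty 3 crash) \<le> 1")
    case True
    have "\<exists>L. \<forall>i<3. (\<lambda>t. x t i) \<longlonglongrightarrow> L"
    proof (rule one_fault_converge[OF _ _ _ _ _ _ fair ex True, where \<alpha> = "max 0 \<alpha>"])
      fix i :: nat assume "i < 3"
      then have i: "\<phi> i = \<xi> \<or> \<phi> i = \<xi>'"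
        using \<phi> by auto
      show "target_scale 3 (\<phi> i) \<le> ereal (max 0 \<alpha>)"
        using i assms(2,3) by auto
      show "target_function 3 (\<phi> i)"
        using i assms(4,5) by (auto simp: FC_compatible_def)
      show "a i \<noteq> 0"
        using a \<open>i < 3\<close> by blast
    qed (use assms(1) in auto)
    then show ?thesis
      by blast
  next
    case False
    have sub: "faulty 3 crash \<subseteq> {..<3}"
      by (auto simp: faulty_def)
    then have "card ({..<3} - faulty 3 crash) = 1"
      using False F by (subst card_Diff_subset) (auto intro: finite_subset)
    then obtain k where k: "{..<3} - faulty 3 crash = {k}"
      by (rule card_1_singletonE)
    then have "k < 3" and Fk: "faulty 3 crash = {..<3} - {k}"
      using sub by auto
    then have "\<phi> k = \<xi> \<or> \<phi> k = \<xi>'"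
      using \<phi> by auto
    then have "FC_compatible 3 (3 - 1) {\<phi> k}"
      using assms(4,5) by auto
    then have "\<exists>L. (\<lambda>t. x t k) \<longlonglongrightarrow> L"
      by (rule single_survivor_converge[OF _ _ fair ex \<open>k < 3\<close> Fk]) (use a in blast)
    then show ?thesis
      unfolding Fk by auto
  qed
  moreover have "\<forall>\<phi>\<in>{\<xi>} \<union> {\<xi>'}. target_function 3 \<phi>"
    using assms(4,5) by (simp add: FC_compatible_def)
  ultimately show ?thesis
    unfolding FC_compatible_def by blast
qed

end

theory Submission
  imports Defs
begin

text \<open>
  A robot goes to the centroid, except that it rests when it has a prescribed role in a
  configuration similar to a prescribed pattern. Let \<open>S\<close> be the set of robots that eventually never
  move. The others contract to the centroid \<open>c\<close> of \<open>S\<close>, which is then the centroid of the limit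
  configuration. A non-faulty robot of \<open>S\<close> away from \<open>c\<close> sees its pattern infinitely often; as no
  point of a pattern is near its centroid, all robots are then in \<open>S\<close>, and as a pattern has a
  single resting place, all non-faulty robots are there.

  Two such targets with different resting places in the same pattern can both rest forever. With
  centroid \<open>0\<close> the pattern consists of \<open>1\<close> and a negative number, where robots crash, and of \<open>\<alpha>\<close> and
  copies of \<open>\<alpha>\<^sup>2\<close>, the resting places. Resting at \<open>\<alpha>\<close> has scale exactly \<open>\<alpha>\<close> but resting at \<open>\<alpha>\<^sup>2\<close>
  has a smaller one, so the second target gets another pattern to reach \<open>\<alpha>\<close>.
\<close>

section \<open>Averaging with resting robots\<close>

text \<open>Robots of \<open>F\<close> end up in \<open>S\<close>, so \<open>F \<noteq> {}\<close>
  keeps some robot fixed, and the movers' distances from the centroid \<open>c\<close> of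
  \<open>S\<close> shrink by the factor \<open>card M / n < 1\<close>. The non-faulty robots of
  \<open>S\<close> are handled by \<open>away\<close> if there are movers and by
  \<open>unique\<close> if there are none.\<close>

lemma averaging_with_rests_converges:
  fixes n :: nat and x :: "nat \<Rightarrow> nat \<Rightarrow> complex" and rest :: "(nat \<Rightarrow> complex) \<Rightarrow> nat \<Rightarrow> bool"
  defines "avg \<equiv> \<lambda>p. (\<Sum>j<n. p j) /\<^sub>R real n"
  assumes update: "\<And>t i. i < n \<Longrightarrow>
      x (Suc t) i = (if act t i \<and> \<not> rest (x t) i then avg (x t) else x t i)"
    and inf: "\<And>i. i < n \<Longrightarrow> i \<notin> F \<Longrightarrow> \<exists>\<^sub>\<infinity>t. act t i"
    and fin: "\<And>i. i \<in> F \<Longrightarrow> \<exists>T. \<forall>t\<ge>T. \<not> act t i"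
    and F: "F \<noteq> {}" "F \<subseteq> {..<n}"
    and \<epsilon>: "\<epsilon> > 0"
    and away: "\<And>p i j. rest p i \<Longrightarrow> i < n \<Longrightarrow> j < n \<Longrightarrow> \<epsilon> * dist (p i) (avg p) \<le> dist (p j) (avg p)"
    and unique: "\<And>p q i j. rest p i \<Longrightarrow> rest q j \<Longrightarrow> \<forall>k<n. p k = q k \<Longrightarrow> i < n \<Longrightarrow> j < n \<Longrightarrow> p i = p j"
  shows "\<exists>L. \<forall>i<n. i \<notin> F \<longrightarrow> (\<lambda>t. x t i) \<longlonglongrightarrow> L"
proof -
  define mv where "mv t i \<longleftrightarrow> act t i \<and> \<not> rest (x t) i" for t i
  \<comment> \<open>Membership counts moves to the centroid, even those that happen to leave the
    position unchanged.\<close>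
  define M where "M = {i. i < n \<and> (\<exists>\<^sub>\<infinity>t. mv t i)}"
  define S where "S = {..<n} - M"
  have "n > 0" using F by auto
  have finM: "finite M" "M \<subseteq> {..<n}" by (auto simp: M_def)
  have finS: "finite S" by (simp add: S_def)
  have "F \<subseteq> S"
    using fin F(2) unfolding S_def M_def mv_def INFM_nat_le by blast
  then have S0: "S \<noteq> {}" using F(1) by blast
  have "\<exists>T. \<forall>i<n. \<forall>t\<ge>T. i \<in> S \<longrightarrow> \<not> mv t i"
  proof (rule ex_stage, intro allI impI)
    fix i assume "i < n"
    then show "\<exists>T. \<forall>t\<ge>T. i \<in> S \<longrightarrow> \<not> mv t i"
      by (cases "i \<in> S") (auto simp: S_def M_def INFM_nat_le)
  qed
  then obtain T where T: "\<And>i t. i \<in> S \<Longrightarrow> t \<ge> T \<Longrightarrow> \<not> mv t i"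
    by (auto simp: S_def)
  have still: "x t i = x T i" if "i \<in> S" "t \<ge> T" for t i
    using that(2)
  proof (induction t rule: dec_induct)
    case (step t)
    then show ?case
      using T[OF that(1), of t] update[of i t] that(1) by (auto simp: S_def mv_def)
  qed simp
  have still_lim: "(\<lambda>t. x t i) \<longlonglongrightarrow> x T i" if "i \<in> S" for i
    by (rule tendsto_eventually) (use still[OF that] in \<open>unfold eventually_sequentially, blast\<close>)
  \<comment> \<open>A non-faulty robot of \<open>S\<close> is still activated infinitely often, so
    each late activation finds it told to rest.\<close>
  have rests: "\<exists>\<^sub>\<infinity>t. rest (x t) i \<and> t \<ge> T" if "i \<in> S" "i \<notin> F" for i
  proof -
    have "\<exists>\<^sub>\<infinity>t. act t i" using inf that by (simp add: S_def)
    moreover have "\<forall>\<^sub>\<infinity>t. t \<ge> T"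
      unfolding MOST_nat_le by blast
    ultimately have "\<exists>\<^sub>\<infinity>t. act t i \<and> t \<ge> T" by (simp add: INFM_conjI)
    then show ?thesis
      by (rule INFM_mono) (use T[OF that(1)] in \<open>auto simp: mv_def\<close>)
  qed
  show ?thesis
  proof (cases "M = {}")
    case True
    then have S: "S = {..<n}" by (simp add: S_def)
    have same: "x T i = x T j" if ij: "i < n" "j < n" "i \<notin> F" "j \<notin> F" for i j
    proof -
      have "i \<in> S" "j \<in> S"
        using ij S by auto
      then obtain t t' where tt': "rest (x t) i" "t \<ge> T" "rest (x t') j" "t' \<ge> T"
        using INFM_EX[OF rests[OF _ ij(3)]] INFM_EX[OF rests[OF _ ij(4)]] by blast
      \<comment> \<open>Without movers the configuration is frozen after \<open>T\<close>. Positions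
        at indices from \<open>n\<close> on are unconstrained, which is why \<open>unique\<close>
        compares two functions that agree only below \<open>n\<close>.\<close>
      have "\<forall>k<n. x t k = x t' k"
        using still[OF _ tt'(2)] still[OF _ tt'(4)] unfolding S by simp
      then have "x t i = x t j"
        by (rule unique[OF tt'(1,3) _ ij(1,2)])
      then show ?thesis
        using still[OF \<open>i \<in> S\<close> tt'(2)] still[OF \<open>j \<in> S\<close> tt'(2)] by simp
    qed
    have "(\<lambda>t. x t i) \<longlonglongrightarrow> x T j" if "i < n" "j < n" "i \<notin> F" "j \<notin> F" for i j
      using still_lim[of i] same[OF that] S that(1) by simp
    then show ?thesis by blast
  next
    case False
    then obtain m where m: "m \<in> M" by blast
    define c where "c = (\<Sum>i\<in>S. x T i) /\<^sub>R real (card S)"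
    define q where "q = real (card M) / real n"
    have cardn: "card M + card S = n"
      unfolding S_def using finM card_mono[of "{..<n}" M] by (simp add: card_Diff_subset)
    have cS: "card S > 0" using S0 finS by (simp add: card_gt_0_iff)
    have q: "0 \<le> q" "q < 1"
      using cS cardn \<open>n > 0\<close> by (auto simp: q_def)
    \<comment> \<open>The deviations of the fixed robots from their own centroid \<open>c\<close>
      cancel; only the movers contribute, while the divisor stays \<open>n\<close>.\<close>
    have avg_c: "avg (x t) - c = (\<Sum>i\<in>M. x t i - c) /\<^sub>R real n" if "t \<ge> T" for t
    proof -
      have "(\<Sum>i<n. x t i - c) = (\<Sum>i\<in>M. x t i - c) + (\<Sum>i\<in>S. x t i - c)"
        unfolding S_def using finM by (simp add: sum.subset_diff)
      also have "(\<Sum>i\<in>S. x t i - c) = (\<Sum>i\<in>S. x T i) - real (card S) *\<^sub>R c"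
        using still[OF _ that] by (simp add: sum_subtractf scaleR_conv_of_real)
      also have "\<dots> = 0"
        using cS by (simp add: c_def)
      finally have eq: "(\<Sum>i<n. x t i) - real n *\<^sub>R c = (\<Sum>i\<in>M. x t i - c)"
        by (simp add: sum_subtractf scaleR_conv_of_real)
      have "avg (x t) - c = ((\<Sum>i<n. x t i) - real n *\<^sub>R c) /\<^sub>R real n"
        using \<open>n > 0\<close> by (simp add: avg_def scaleR_diff_right)
      then show ?thesis
        unfolding eq .
    qed
    have avg_bound: "dist (avg (x t)) c \<le> q * D" if "t \<ge> T" "\<forall>i\<in>M. dist (x t i) c \<le> D" for t D
    proof -
      have "norm (\<Sum>i\<in>M. x t i - c) \<le> (\<Sum>i\<in>M. D)"
        using that(2) by (intro sum_norm_le) (simp add: dist_norm)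
      then show ?thesis
        unfolding dist_norm avg_c[OF that(1)] using \<open>n > 0\<close> by (simp add: q_def divide_simps mult.commute)
    qed
    define B where "B = (\<Sum>i\<in>M. dist (x T i) c)"
    have B: "dist (x T i) c \<le> B" if "i \<in> M" for i
      unfolding B_def using finM that by (intro member_le_sum) auto
    have B0: "B \<ge> 0" unfolding B_def by (intro sum_nonneg) auto
    have base: "dist (x t i) c \<le> B" if "t \<ge> T" "i \<in> M" for t i
      using that
    proof (induction t arbitrary: i rule: dec_induct)
      case base
      then show ?case using B by simp
    next
      case (step t)
      have "dist (avg (x t)) c \<le> q * B"
        using step by (intro avg_bound) auto
      also have "\<dots> \<le> B" using q B0 by (simp add: mult_left_le_one_le)
      finally show ?case
        using step.IH[OF step.prems] update[of i t] step.prems finM by (auto split: if_splits)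
    qed
    \<comment> \<open>Once all movers are within \<open>q ^ k * B\<close> of \<open>c\<close>, every
      average is within \<open>q ^ Suc k * B\<close>; each mover enters this smaller ball at its
      next move and never leaves it.\<close>
    have contract: "\<exists>T'\<ge>T. \<forall>t\<ge>T'. \<forall>i\<in>M. dist (x t i) c \<le> q ^ k * B" for k
    proof (induction k)
      case 0
      then show ?case using base by auto
    next
      case (Suc k)
      then obtain T' where T': "T' \<ge> T" "\<And>t i. t \<ge> T' \<Longrightarrow> i \<in> M \<Longrightarrow> dist (x t i) c \<le> q ^ k * B"
        by blast
      have av: "dist (avg (x t)) c \<le> q ^ Suc k * B" if "t \<ge> T'" for t
        using avg_bound[of t "q ^ k * B"] T' that by (simp add: mult.assoc)
      have "\<exists>T''. \<forall>i<n. \<forall>t\<ge>T''. i \<in> M \<longrightarrow> dist (x t i) c \<le> q ^ Suc k * B"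
      proof (rule ex_stage, intro allI impI)
        fix i assume "i < n"
        show "\<exists>T''. \<forall>t\<ge>T''. i \<in> M \<longrightarrow> dist (x t i) c \<le> q ^ Suc k * B"
        proof (cases "i \<in> M")
          case True
          then obtain s where s: "s \<ge> T'" "mv s i"
            by (auto simp: M_def INFM_nat_le)
          have "dist (x t i) c \<le> q ^ Suc k * B" if "t \<ge> Suc s" for t
            using that
          proof (induction t rule: dec_induct)
            case base
            then show ?case
              using update[OF \<open>i < n\<close>, of s] s av[of s] by (simp add: mv_def)
          next
            case (step t)
            then show ?case
              using update[OF \<open>i < n\<close>, of t] s av[of t] by (auto split: if_splits)
          qed
          then show ?thesis by blast
        qed auto
      qed
      then obtain T'' where "\<And>i t. i < n \<Longrightarrow> t \<ge> T'' \<Longrightarrow> i \<in> M \<Longrightarrow> dist (x t i) c \<le> q ^ Suc k * B"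
        by blast
      then show ?case
        using T'(1) finM by (intro exI[of _ "max T T''"]) auto
    qed
    have small: "\<exists>T'\<ge>T. \<forall>t\<ge>T'. \<forall>i\<in>M. dist (x t i) c < e" if "e > 0" for e
    proof -
      have "(\<lambda>k. q ^ k * B) \<longlonglongrightarrow> 0 * B"
        using q by (intro tendsto_mult_right LIMSEQ_power_zero) auto
      then have "\<forall>\<^sub>F k in sequentially. q ^ k * B < e"
        using that by (intro order_tendstoD(2)) auto
      then obtain k where "q ^ k * B < e"
        by (auto simp: eventually_sequentially)
      then show ?thesis
        using contract[of k] by (meson le_less_trans)
    qed
    have limM: "(\<lambda>t. x t i) \<longlonglongrightarrow> c" if "i \<in> M" for i
      unfolding lim_sequentially using small that by blast
    have limavg: "(\<lambda>t. avg (x t)) \<longlonglongrightarrow> c"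
      unfolding lim_sequentially
    proof (intro allI impI)
      fix e :: real assume "e > 0"
      then obtain T' where T': "T' \<ge> T" "\<forall>t\<ge>T'. \<forall>i\<in>M. dist (x t i) c < e / 2"
        using small[of "e / 2"] by auto
      have "dist (avg (x t)) c < e" if "t \<ge> T'" for t
      proof -
        have "dist (avg (x t)) c \<le> q * (e / 2)"
          using T' that by (intro avg_bound) (auto intro: less_imp_le)
        also have "\<dots> \<le> e / 2" using q \<open>e > 0\<close> by (simp add: mult_left_le_one_le)
        finally show ?thesis using \<open>e > 0\<close> by simp
      qed
      then show "\<exists>no. \<forall>t\<ge>no. dist (avg (x t)) c < e" by blast
    qed
    have "x T i = c" if i: "i \<in> S" "i \<notin> F" for i
    proof (rule ccontr)
      assume "x T i \<noteq> c"
      \<comment> \<open>The mover \<open>m\<close> and the average both tend to \<open>c\<close>, so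
        \<open>m\<close> is eventually closer to the average than \<open>away\<close> permits while
        \<open>i\<close> rests.\<close>
      have "(\<lambda>t. \<epsilon> * dist (x T i) (avg (x t)) - dist (x t m) (avg (x t)))
          \<longlonglongrightarrow> \<epsilon> * dist (x T i) c - dist c c"
        by (intro tendsto_intros limavg limM m)
      moreover have "\<epsilon> * dist (x T i) c - dist c c > 0"
        using \<epsilon> \<open>x T i \<noteq> c\<close> by simp
      ultimately have "\<forall>\<^sub>F t in sequentially.
          \<epsilon> * dist (x T i) (avg (x t)) - dist (x t m) (avg (x t)) > 0"
        by (rule order_tendstoD(1))
      then obtain N where N:
        "\<And>t. t \<ge> N \<Longrightarrow> \<epsilon> * dist (x T i) (avg (x t)) > dist (x t m) (avg (x t))"
        by (auto simp: eventually_sequentially)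
      obtain t where "t \<ge> N" "rest (x t) i" "t \<ge> T"
        using rests[OF i] by (auto simp: INFM_nat_le)
      then show False
        using away[of "x t" i m] N[of t] still[OF i(1), of t] i m finM by (auto simp: S_def)
    qed
    then have "(\<lambda>t. x t i) \<longlonglongrightarrow> c" if "i \<in> S" "i \<notin> F" for i
      using still_lim[OF that(1)] that by simp
    then show ?thesis
      using limM by (intro exI[of _ c]) (auto simp: S_def)
  qed
qed

section \<open>Resting patterns\<close>

text \<open>
  A pattern \<open>(Q, s)\<close> tells the robot at the place of \<open>s\<close> to rest whenever the configuration is
  similar to \<open>Q\<close>.
\<close>

type_synonym patterns = "(complex multiset \<times> complex) set"

text \<open>The maps \<open>g + a * z\<close> with \<open>a \<noteq> 0\<close> are the
  orientation-preserving similarities, hence exactly the changes between right-handed frames, so a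
  match does not depend on the observer.\<close>

definition resting :: "patterns \<Rightarrow> complex multiset \<Rightarrow> complex \<Rightarrow> bool" where
  "resting K P w \<longleftrightarrow>
     (\<exists>Q s g a. (Q, s) \<in> K \<and> a \<noteq> 0 \<and> w = g + a * s \<and> P = image_mset (\<lambda>z. g + a * z) Q)"

definition resting_target :: "patterns \<Rightarrow> target" where
  "resting_target K P =
     (if 0 \<in># P then Some (if resting K P 0 then 0 else centroid P) else None)"

lemma target_function_resting_target: "target_function n (resting_target K)"
  by (simp add: target_function_def resting_target_def)

section \<open>Invariance under changes of frame\<close>

lemma sum_mset_affine:
  "sum_mset (image_mset (\<lambda>z. c + a * z) P) = of_nat (size P) * c + a * sum_mset P"
  for a c :: complex
  by (induction P) (simp_all add: algebra_simps)

lemma centroid_affine: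
  assumes "P \<noteq> {#}"
  shows "centroid (image_mset (\<lambda>z. c + a * z) P) = c + a * centroid P"
proof -
  have "size P \<noteq> 0"
    using assms by simp
  then show ?thesis
    unfolding centroid_def sum_mset_affine by (simp add: scaleR_conv_of_real field_simps)
qed

lemma resting_affine:
  assumes "resting K P w" and "d \<noteq> 0"
  shows "resting K (image_mset (\<lambda>z. c + d * z) P) (c + d * w)"
proof -
  obtain Q s g a where "(Q, s) \<in> K" "a \<noteq> 0" "w = g + a * s" "P = image_mset (\<lambda>z. g + a * z) Q"
    using assms(1) by (auto simp: resting_def)
  then show ?thesis
    unfolding resting_def using assms(2)
    by (intro exI[of _ Q] exI[of _ s] exI[of _ "c + d * g"] exI[of _ "d * a"])
      (simp add: image_mset.compositionality o_def algebra_simps)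
qed

lemma resting_to_local_iff:
  assumes "a \<noteq> 0"
  shows "resting K (image_mset (to_local c a) P) (to_local c a w) \<longleftrightarrow> resting K P w"
proof
  assume "resting K (image_mset (to_local c a) P) (to_local c a w)"
  from resting_affine[OF this assms, of c] show "resting K P w"
    using assms by (simp add: image_mset.compositionality o_def to_local_def)
next
  assume "resting K P w"
  then have "resting K (image_mset (\<lambda>z. - c / a + 1 / a * z) P) (- c / a + 1 / a * w)"
    by (rule resting_affine) (use assms in simp)
  then show "resting K (image_mset (to_local c a) P) (to_local c a w)"
    by (simp add: to_local_def[abs_def] diff_divide_distrib)
qed

text \<open>Matches and centroids commute with similarities, so the frame \<open>a\<close> drops out
  and the move can be read in global coordinates.\<close>

lemma next_position_resting_target:
  assumes "a \<noteq> 0" and "i < n"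
  shows "next_position n (resting_target K) a p i =
    (if resting K (configuration n p) (p i) then p i else centroid (configuration n p))"
proof -
  let ?P = "configuration n p"
  have "p i \<in># ?P"
    using assms(2) by (auto simp: configuration_def)
  then have "to_local (p i) a (p i) \<in># image_mset (to_local (p i) a) ?P"
    by simp
  then have mem: "0 \<in># image_mset (to_local (p i) a) ?P"
    by (simp add: to_local_def)
  have rest: "resting K (image_mset (to_local (p i) a) ?P) 0 \<longleftrightarrow> resting K ?P (p i)"
    using resting_to_local_iff[OF assms(1), of K "p i" ?P "p i"] by (simp add: to_local_def)
  have "?P \<noteq> {#}"
    using \<open>p i \<in># ?P\<close> by auto
  then have "centroid (image_mset (\<lambda>z. - p i / a + 1 / a * z) ?P) = - p i / a + 1 / a * centroid ?P"
    by (rule centroid_affine)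
  then have "centroid (image_mset (to_local (p i) a) ?P) = to_local (p i) a (centroid ?P)"
    by (simp add: to_local_def[abs_def] diff_divide_distrib)
  then show ?thesis
    using mem rest to_global_to_local[OF assms(1), of "p i" "centroid ?P"]
    by (simp add: next_position_def resting_target_def to_global_def)
qed

lemma centroid_configuration: "centroid (configuration n p) = (\<Sum>j<n. p j) /\<^sub>R real n"
  by (simp add: centroid_def configuration_def sum_unfold_sum_mset)

text \<open>Conditions under which the target has scale \<alpha> and converges.
  \<open>centred\<close> makes the translation part of a match its centroid; \<open>scaled\<close>
  bounds the scale by \<alpha> and \<open>extremal\<close> makes it reach \<alpha>;
  \<open>off_centroid\<close> and \<open>rigid\<close> supply \<open>away\<close> and
  \<open>unique\<close> of \<open>averaging_with_rests_converges\<close>.\<close>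

locale resting_patterns =
  fixes n :: nat and \<alpha> \<epsilon> :: real and K :: patterns
  assumes n: "0 < n" and \<alpha>: "0 < \<alpha>" "\<alpha> < 1" and \<epsilon>: "0 < \<epsilon>"
    and size_pattern: "(Q, s) \<in> K \<Longrightarrow> size Q = n"
    and centred: "(Q, s) \<in> K \<Longrightarrow> sum_mset Q = 0"
    and scaled: "(Q, s) \<in> K \<Longrightarrow> \<exists>y\<in>#Q. s = of_real \<alpha> * y"
    and off_centroid: "(Q, s) \<in> K \<Longrightarrow> z \<in># Q \<Longrightarrow> \<epsilon> * norm s \<le> norm z"
    and rigid: "(Q, s) \<in> K \<Longrightarrow> (Q', s') \<in> K \<Longrightarrow> a \<noteq> 0 \<Longrightarrow> a' \<noteq> 0 \<Longrightarrow>
      image_mset ((*) a) Q = image_mset ((*) a') Q' \<Longrightarrow> a * s = a' * s'"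
    and extremal: "\<exists>Q. (Q, of_real \<alpha>) \<in> K \<and> of_real \<alpha> \<in># Q \<and> (\<forall>z\<in>#Q. Re z \<le> 1)"
begin

lemma centroid_pattern:
  assumes "(Q, s) \<in> K"
  shows "centroid (image_mset (\<lambda>z. g + a * z) Q) = g"
proof -
  have "Q \<noteq> {#}"
    using size_pattern[OF assms] n by auto
  then show ?thesis
    using centred[OF assms] by (simp add: centroid_affine) (simp add: centroid_def)
qed

lemma resting_away:
  assumes "resting K P w" and "v \<in># P"
  shows "\<epsilon> * dist w (centroid P) \<le> dist v (centroid P)"
proof -
  obtain Q s g a where K: "(Q, s) \<in> K" "a \<noteq> 0" "w = g + a * s" "P = image_mset (\<lambda>z. g + a * z) Q"
    using assms(1) by (auto simp: resting_def)
  obtain z where z: "z \<in># Q" "v = g + a * z"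
    using assms(2) K(4) by auto
  have "norm a * (\<epsilon> * norm s) \<le> norm a * norm z"
    using off_centroid[OF K(1) z(1)] by (intro mult_left_mono) auto
  then show ?thesis
    using K z centroid_pattern[OF K(1), of g a]
    by (simp add: dist_norm norm_mult mult.left_commute)
qed

text \<open>Both matches have the centroid of \<open>P\<close> as translation part; subtracting it
  leaves two multiplications by complex factors, which \<open>rigid\<close> compares.\<close>

lemma resting_unique:
  assumes "resting K P w" and "resting K P w'"
  shows "w = w'"
proof -
  obtain Q s g a where K: "(Q, s) \<in> K" "a \<noteq> 0" "w = g + a * s" "P = image_mset (\<lambda>z. g + a * z) Q"
    using assms(1) by (auto simp: resting_def)
  obtain Q' s' g' a' where K': "(Q', s') \<in> K" "a' \<noteq> 0" "w' = g' + a' * s'"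
    "P = image_mset (\<lambda>z. g' + a' * z) Q'"
    using assms(2) by (auto simp: resting_def)
  have g: "g = g'"
    using centroid_pattern[OF K(1), of g a] centroid_pattern[OF K'(1), of g' a'] K(4) K'(4) by simp
  have "image_mset (\<lambda>z. z - g) (image_mset (\<lambda>z. g + a * z) Q) =
      image_mset (\<lambda>z. z - g) (image_mset (\<lambda>z. g' + a' * z) Q')"
    using K(4) K'(4) by simp
  then have "image_mset ((*) a) Q = image_mset ((*) a') Q'"
    by (simp add: image_mset.compositionality o_def g)
  then show ?thesis
    using rigid[OF K(1) K'(1) K(2) K'(2)] K(3) K'(3) g by simp
qed

text \<open>Going to the centroid has scale \<open>0\<close>. A resting place is a point of the
  configuration contracted by \<alpha> towards the centroid, so staying there has scale at most
  \<alpha>.\<close>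

lemma scale_at_le:
  assumes "size P = n"
  shows "scale_at (resting_target K) P \<le> ereal \<alpha>"
proof (cases "0 \<in># P")
  case False
  then show ?thesis
    using \<alpha> by (simp add: scale_at_def resting_target_def)
next
  case True
  then have hull: "0 \<in> convex hull (set_mset P)"
    by (simp add: hull_inc)
  show ?thesis
  proof (cases "resting K P 0")
    case False
    have "centroid P \<in> scaled_hull 0 P"
      unfolding scaled_hull_def using hull by (intro image_eqI[of _ _ 0]) auto
    then have "Inf {ereal d | d. 0 \<le> d \<and> centroid P \<in> scaled_hull d P} \<le> ereal 0"
      by (intro Inf_lower) auto
    then show ?thesis
      using True False \<alpha> by (simp add: scale_at_def resting_target_def order_trans)
  next
    case rest: True
    then obtain Q s g a where K: "(Q, s) \<in> K" "0 = g + a * s" "P = image_mset (\<lambda>z. g + a * z) Q"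
      by (auto simp: resting_def)
    obtain y where y: "y \<in># Q" "s = of_real \<alpha> * y"
      using scaled[OF K(1)] by blast
    have "0 = \<alpha> *\<^sub>R (g + a * y) + (1 - \<alpha>) *\<^sub>R g"
      using K(2) y(2) by (simp add: scaleR_conv_of_real algebra_simps)
    moreover have "g + a * y \<in> convex hull (set_mset P)"
      using K(3) y(1) by (auto intro!: hull_inc)
    ultimately have "0 \<in> scaled_hull \<alpha> P"
      unfolding scaled_hull_def using centroid_pattern[OF K(1), of g a] K(3) by (intro image_eqI) auto
    then have "Inf {ereal d | d. 0 \<le> d \<and> 0 \<in> scaled_hull d P} \<le> ereal \<alpha>"
      using \<alpha> by (intro Inf_lower) auto
    then show ?thesis
      using True rest by (simp add: scale_at_def resting_target_def)
  qed
qed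

lemma target_scale_resting_target: "target_scale n (resting_target K) = ereal \<alpha>"
proof (rule antisym)
  show "target_scale n (resting_target K) \<le> ereal \<alpha>"
    unfolding target_scale_def using scale_at_le by (intro SUP_least) simp
  obtain Q where Q: "(Q, of_real \<alpha>) \<in> K" "of_real \<alpha> \<in># Q" "\<And>z. z \<in># Q \<Longrightarrow> Re z \<le> 1"
    using extremal by blast
  \<comment> \<open>The shift puts the resting robot at \<open>0\<close>, so the centroid is at
    \<open>- \<alpha>\<close> and no real part exceeds \<open>1 - \<alpha>\<close>. Measured along
    the real axis, the hull reaches at most \<open>1\<close> past the centroid while
    \<open>0\<close> is \<alpha> past it, so a factor of at least \<alpha> is needed.\<close>
  define P where "P = image_mset (\<lambda>z. - of_real \<alpha> + 1 * z) Q"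
  have "0 \<in># P"
    using Q(2) by (force simp: P_def)
  moreover have "resting K P 0"
    unfolding resting_def P_def using Q(1)
    by (intro exI[of _ Q] exI[of _ "of_real \<alpha>"] exI[of _ "- of_real \<alpha>"] exI[of _ 1]) simp
  ultimately have P0: "resting_target K P = Some 0"
    by (simp add: resting_target_def)
  have "convex hull (set_mset P) \<subseteq> {z. inner 1 z \<le> 1 - \<alpha>}"
    using Q(3) by (intro hull_minimal convex_halfspace_le) (auto simp: P_def inner_complex_def)
  moreover have "{z. inner 1 z \<le> 1 - \<alpha>} = {z. Re z \<le> 1 - \<alpha>}"
    by (simp add: inner_complex_def)
  ultimately have hull: "Re z \<le> 1 - \<alpha>" if "z \<in> convex hull (set_mset P)" for z
    using that by blast
  have "\<alpha> \<le> d" if d: "0 \<le> d" "0 \<in> scaled_hull d P" for d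
  proof -
    obtain z where z: "z \<in> convex hull (set_mset P)" "0 = d *\<^sub>R z + (1 - d) *\<^sub>R centroid P"
      using d(2) by (auto simp: scaled_hull_def)
    then have "0 = Re (d *\<^sub>R z + (1 - d) *\<^sub>R (- of_real \<alpha>))"
      using centroid_pattern[OF Q(1), of "- of_real \<alpha>" 1] by (simp add: P_def)
    then have "(1 - d) * \<alpha> = d * Re z"
      by simp
    also have "\<dots> \<le> d * (1 - \<alpha>)"
      using hull[OF z(1)] d(1) by (intro mult_left_mono)
    finally show ?thesis
      by (simp add: algebra_simps)
  qed
  then have "ereal \<alpha> \<le> scale_at (resting_target K) P"
    by (auto simp: scale_at_def P0 intro!: Inf_greatest)
  also have "\<dots> \<le> target_scale n (resting_target K)"
    unfolding target_scale_def using size_pattern[OF Q(1)] by (intro SUP_upper) (simp add: P_def)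
  finally show "ereal \<alpha> \<le> target_scale n (resting_target K)" .
qed

text \<open>With a faulty robot the averaging lemma applies; without one, a scale below
  \<open>1\<close> alone forces convergence by \<open>one_fault_converge\<close>.\<close>

lemma FC_compatible_resting_target: "FC_compatible n f {resting_target K}"
proof -
  have "\<exists>L. \<forall>i<n. i \<notin> faulty n crash \<longrightarrow> (\<lambda>t. x t i) \<longlonglongrightarrow> L"
    if \<phi>: "\<forall>i<n. \<phi> i \<in> {resting_target K}" and a: "\<forall>i<n. a i \<noteq> 0" and fair: "fair n A"
      and ex: "execution n \<phi> a A crash x" for \<phi> a A crash x
  proof (cases "faulty n crash = {}")
    case True
    have "\<exists>L. \<forall>i<n. (\<lambda>t. x t i) \<longlonglongrightarrow> L"
      using \<phi> a \<alpha> n True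
      by (intro one_fault_converge[OF _ _ _ _ _ _ fair ex, where \<alpha> = \<alpha>])
        (simp_all add: target_scale_resting_target target_function_resting_target)
    then show ?thesis
      by blast
  next
    case False
    show ?thesis
    proof (rule averaging_with_rests_converges[where \<epsilon> = \<epsilon>
          and act = "\<lambda>t i. i \<in> A t \<and> \<not> crash i \<le> enat t"
          and rest = "\<lambda>p i. resting K (configuration n p) (p i)"])
      fix t i assume "i < n"
      then show "x (Suc t) i = (if (i \<in> A t \<and> \<not> crash i \<le> enat t) \<and>
          \<not> resting K (configuration n (x t)) (x t i) then (\<Sum>j<n. x t j) /\<^sub>R real n else x t i)"
        using ex \<phi> a
        by (simp add: execution_def next_position_resting_target centroid_configuration)
    next
      fix i assume "i < n" "i \<notin> faulty n crash"
      then show "\<exists>\<^sub>\<infinity>t. i \<in> A t \<and> \<not> crash i \<le> enat t"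
        using fair by (simp add: fair_def faulty_def)
    next
      fix i assume "i \<in> faulty n crash"
      then obtain T where "crash i = enat T"
        by (auto simp: faulty_def)
      then show "\<exists>T. \<forall>t\<ge>T. \<not> (i \<in> A t \<and> \<not> crash i \<le> enat t)"
        by auto
    next
      show "faulty n crash \<noteq> {}" "faulty n crash \<subseteq> {..<n}" "0 < \<epsilon>"
        using False \<epsilon> by (auto simp: faulty_def)
    next
      fix p i j assume "resting K (configuration n p) (p i)" "i < n" "j < n"
      then show "\<epsilon> * dist (p i) ((\<Sum>j<n. p j) /\<^sub>R real n) \<le> dist (p j) ((\<Sum>j<n. p j) /\<^sub>R real n)"
        unfolding centroid_configuration[symmetric]
        by (intro resting_away) (auto simp: configuration_def)
    next
      fix p q :: "nat \<Rightarrow> complex" and i j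
      assume rest: "resting K (configuration n p) (p i)" "resting K (configuration n q) (q j)"
        and eq: "\<forall>k<n. p k = q k" and ij: "i < n" "j < n"
      have "configuration n p = configuration n q"
        unfolding configuration_def using eq by (intro image_mset_cong) simp
      then show "p i = p j"
        using resting_unique rest eq ij by metis
    qed
  qed
  then show ?thesis
    unfolding FC_compatible_def using target_function_resting_target by blast
qed

end

section \<open>Rigid collinear patterns\<close>

text \<open>Modulus of the negative point of \<open>shape\<close>, chosen so that the points sum to
  \<open>0\<close>.\<close>

definition shape_tail :: "nat \<Rightarrow> real \<Rightarrow> real \<Rightarrow> real" where
  "shape_tail n \<alpha> v = 1 + \<alpha> + real (n - 3) * v"

definition shape :: "nat \<Rightarrow> real \<Rightarrow> real \<Rightarrow> complex multiset" where
  "shape n \<alpha> v = {#1, of_real \<alpha>, - of_real (shape_tail n \<alpha> v)#} + replicate_mset (n - 3) (of_real v)"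

lemma size_shape: "3 \<le> n \<Longrightarrow> size (shape n \<alpha> v) = n"
  by (simp add: shape_def)

lemma sum_shape: "sum_mset (shape n \<alpha> v) = 0"
  by (simp add: shape_def shape_tail_def)

lemma shape_elem:
  assumes "z \<in># shape n \<alpha> v" and "0 < \<alpha>" and "\<alpha> < 1" and "0 < v" and "v \<le> 1"
  shows "z = - of_real (shape_tail n \<alpha> v) \<or> (\<exists>r. z = of_real r \<and> min \<alpha> v \<le> r \<and> r \<le> 1)"
  using assms by (auto simp: shape_def split: if_splits intro: exI[of _ 1])

lemma shape_tail_gt_1: "0 < \<alpha> \<Longrightarrow> 0 < v \<Longrightarrow> 1 < shape_tail n \<alpha> v"
  by (simp add: shape_tail_def add_pos_nonneg)

text \<open>The image of the negative point of one shape lies in the image of the other shape, where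
  the negative point has the largest modulus.\<close>

lemma shape_norm_le:
  assumes sub: "image_mset ((*) a) (shape n \<alpha> v) = image_mset ((*) a') (shape n \<alpha> v')"
    and \<alpha>: "0 < \<alpha>" "\<alpha> < 1" and v: "0 < v" "v \<le> 1" "0 < v'" "v' \<le> 1"
  shows "norm a * shape_tail n \<alpha> v \<le> norm a' * shape_tail n \<alpha> v'"
proof -
  have "a * - of_real (shape_tail n \<alpha> v) \<in># image_mset ((*) a) (shape n \<alpha> v)"
    by (simp add: shape_def)
  then obtain z where z: "z \<in># shape n \<alpha> v'" "a * - of_real (shape_tail n \<alpha> v) = a' * z"
    unfolding sub by auto
  have "norm z \<le> shape_tail n \<alpha> v'"
    using shape_elem[OF z(1) \<alpha> v(3,4)] shape_tail_gt_1[OF \<alpha>(1) v(3), of n] \<alpha> v by auto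
  then have "norm (a' * z) \<le> norm a' * shape_tail n \<alpha> v'"
    by (simp add: norm_mult mult_left_mono)
  then show ?thesis
    using shape_tail_gt_1[OF \<alpha>(1) v(1), of n] by (simp flip: z(2) add: norm_mult)
qed

text \<open>By \<open>ab\<close> the negative points correspond. The image of the point
  \<open>1\<close> is then the image of a point \<open>z\<close> of the other shape;
  \<open>z\<close> is the quotient of the tails, and \<open>Re z \<le> 1\<close>.\<close>

lemma shape_tail_le:
  assumes eq: "image_mset ((*) a) (shape n \<alpha> v) = image_mset ((*) a') (shape n \<alpha> v')"
    and ab: "a * of_real (shape_tail n \<alpha> v) = a' * of_real (shape_tail n \<alpha> v')"
    and \<alpha>: "0 < \<alpha>" "\<alpha> < 1" and v: "0 < v" "v \<le> 1" "0 < v'" "v' \<le> 1"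
    and a: "a \<noteq> 0" "a' \<noteq> 0"
  shows "shape_tail n \<alpha> v' \<le> shape_tail n \<alpha> v"
proof -
  let ?b = "shape_tail n \<alpha> v" and ?b' = "shape_tail n \<alpha> v'"
  have b: "?b > 1" "?b' > 1"
    using shape_tail_gt_1 \<alpha> v by auto
  have "a * 1 \<in># image_mset ((*) a) (shape n \<alpha> v)"
    by (simp add: shape_def)
  then obtain z where z: "z \<in># shape n \<alpha> v'" "a = a' * z"
    unfolding eq by auto
  then have zb: "z * of_real ?b = of_real ?b'"
    using ab a by simp
  then have "Re z * ?b = ?b'"
    by (simp add: complex_eq_iff)
  moreover have "Re z \<le> 1"
    using shape_elem[OF z(1) \<alpha> v(3,4)] b by auto
  then have "Re z * ?b \<le> 1 * ?b"
    using b by (intro mult_right_mono) auto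
  ultimately show ?thesis
    by simp
qed

text \<open>
  The negative point is the only one of largest modulus, which fixes the direction of a similarity;
  the largest positive point is \<open>1\<close> in every shape, which fixes its factor.
\<close>

lemma shape_rigid:
  assumes eq: "image_mset ((*) a) (shape n \<alpha> v) = image_mset ((*) a') (shape n \<alpha> v')"
    and \<alpha>: "0 < \<alpha>" "\<alpha> < 1" and v: "0 < v" "v \<le> 1" "0 < v'" "v' \<le> 1"
    and a: "a \<noteq> 0" "a' \<noteq> 0" and n: "4 \<le> n"
  shows "a = a' \<and> v = v'"
proof -
  let ?b = "shape_tail n \<alpha> v" and ?b' = "shape_tail n \<alpha> v'"
  have b: "?b > 1" "?b' > 1"
    using shape_tail_gt_1 \<alpha> v by auto
  have nb: "norm a * ?b = norm a' * ?b'"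
    using shape_norm_le[OF eq \<alpha> v] shape_norm_le[OF eq[symmetric] \<alpha> v(3,4,1,2)] by simp
  have "a * - of_real ?b \<in># image_mset ((*) a) (shape n \<alpha> v)"
    by (simp add: shape_def)
  then obtain z where z: "z \<in># shape n \<alpha> v'" "a * - of_real ?b = a' * z"
    unfolding eq by auto
  have "norm a * ?b = norm a' * norm z"
    using arg_cong[OF z(2), of norm] b by (simp add: norm_mult)
  then have "norm z = ?b'"
    using nb a by simp
  then have "z = - of_real ?b'"
    using shape_elem[OF z(1) \<alpha> v(3,4)] b \<alpha> v by auto
  then have ab: "a * of_real ?b = a' * of_real ?b'"
    using z(2) by simp
  have "?b = ?b'"
    using shape_tail_le[OF eq ab \<alpha> v a] shape_tail_le[OF eq[symmetric] ab[symmetric] \<alpha> v(3,4,1,2) a(2,1)]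
    by simp
  moreover have "a = a'"
  proof -
    have "complex_of_real ?b' \<noteq> 0"
      using b by simp
    then show ?thesis
      using ab unfolding \<open>?b = ?b'\<close> by simp
  qed
  \<comment> \<open>\<open>4 \<le> n\<close> makes \<open>n - 3\<close> positive, so the tail
    determines \<open>v\<close>.\<close>
  ultimately show ?thesis
    using n by (simp add: shape_tail_def)
qed

section \<open>The two targets and the failure of their union\<close>

theorem theorem7:
  fixes n :: nat and \<alpha> :: real
  assumes "4 \<le> n" and "0 < \<alpha>" and "\<alpha> < 1"
  shows "\<exists>\<xi> \<xi>'. target_function n \<xi> \<and> target_function n \<xi>' \<and>
           target_scale n \<xi> = ereal \<alpha> \<and> target_scale n \<xi>' = ereal \<alpha> \<and>
           (\<forall>f. 2 \<le> f \<and> f \<le> n - 1 \<longrightarrow>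
              FC_compatible n f {\<xi>} \<and> FC_compatible n f {\<xi>'} \<and>
              \<not> FC_compatible n f ({\<xi>} \<union> {\<xi>'}))"
proof -
  let ?a = "complex_of_real \<alpha>" and ?b = "complex_of_real (\<alpha>\<^sup>2)"
  let ?S = "shape n \<alpha> (\<alpha>\<^sup>2)"
  \<comment> \<open>\<open>?b = ?a * ?a\<close> is the point \<open>?a\<close> contracted by
    \<alpha>, as \<open>scaled\<close> requires. In \<open>K'\<close> the pattern with
    \<open>v = 1\<close> provides \<open>extremal\<close>; \<open>shape_rigid\<close> keeps it from
    being confused with \<open>?S\<close>.\<close>
  define K K' where "K = {(?S, ?a)}" and "K' = {(?S, ?b), (shape n \<alpha> 1, ?a)}"
  have sq: "0 < \<alpha>\<^sup>2" "\<alpha>\<^sup>2 < 1" "\<alpha>\<^sup>2 < \<alpha>"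
    using assms power_strict_decreasing[of 0 2 \<alpha>] power_strict_decreasing[of 1 2 \<alpha>] by simp_all
  have a_in: "?a \<in># shape n \<alpha> v" and one_in: "1 \<in># shape n \<alpha> v" for v
    by (simp_all add: shape_def)
  have scaled: "\<exists>y\<in>#shape n \<alpha> v. ?a = ?a * y" "\<exists>y\<in>#shape n \<alpha> v. ?b = ?a * y" for v
    using a_in[of v] one_in[of v] by (force simp: power2_eq_square)+
  \<comment> \<open>Source of the locale's \<open>\<epsilon> = \<alpha>\<^sup>2\<close>: no point of
    either shape has smaller modulus, and the resting places have modulus at most
    \<open>1\<close>.\<close>
  have off: "\<alpha>\<^sup>2 * norm s \<le> norm z"
    if "z \<in># shape n \<alpha> v" "v \<in> {\<alpha>\<^sup>2, 1}" "s \<in> {?a, ?b}" for z v s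
  proof -
    have "\<alpha>\<^sup>2 * norm s \<le> \<alpha>\<^sup>2 * 1"
      using that(3) sq assms by (intro mult_left_mono) (auto simp del: of_real_power)
    also have "\<dots> \<le> norm z"
      using shape_elem[OF that(1) assms(2,3)] shape_tail_gt_1[OF assms(2), of v n] that(2) sq assms
      by auto
    finally show ?thesis .
  qed
  have re: "Re z \<le> 1" if "z \<in># shape n \<alpha> v" "v \<in> {\<alpha>\<^sup>2, 1}" for z v
    using shape_elem[OF that(1) assms(2,3)] shape_tail_gt_1[OF assms(2), of v n] that(2) sq assms
    by auto
  interpret K: resting_patterns n \<alpha> "\<alpha>\<^sup>2" K
  proof
    show "a * s = a' * s'" if "(Q, s) \<in> K" "(Q', s') \<in> K" "a \<noteq> 0" "a' \<noteq> 0"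
      "image_mset ((*) a) Q = image_mset ((*) a') Q'" for Q s Q' s' a a'
      using shape_rigid[of a n \<alpha> "\<alpha>\<^sup>2" a' "\<alpha>\<^sup>2"] that assms sq by (auto simp: K_def)
    show "\<exists>Q. (Q, ?a) \<in> K \<and> ?a \<in># Q \<and> (\<forall>z\<in>#Q. Re z \<le> 1)"
      unfolding K_def using re a_in by blast
    show "\<exists>y\<in>#Q. s = ?a * y" if "(Q, s) \<in> K" for Q s
      using that scaled unfolding K_def by blast
    show "\<alpha>\<^sup>2 * norm s \<le> norm z" if "(Q, s) \<in> K" "z \<in># Q" for Q s z
      using that off unfolding K_def by blast
  qed (use assms in \<open>auto simp: K_def size_shape sum_shape\<close>)
  interpret K': resting_patterns n \<alpha> "\<alpha>\<^sup>2" K'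
  proof
    show "a * s = a' * s'" if K: "(Q, s) \<in> K'" "(Q', s') \<in> K'" and a: "a \<noteq> 0" "a' \<noteq> 0" and
      eq: "image_mset ((*) a) Q = image_mset ((*) a') Q'" for Q s Q' s' a a'
    proof -
      obtain v v' where v: "Q = shape n \<alpha> v" "Q' = shape n \<alpha> v'" and
        s: "(v, s) \<in> {(\<alpha>\<^sup>2, ?b), (1, ?a)}" "(v', s') \<in> {(\<alpha>\<^sup>2, ?b), (1, ?a)}"
        using K unfolding K'_def by blast
      have "a = a' \<and> v = v'"
        by (rule shape_rigid[OF eq[unfolded v] assms(2,3)]) (use s sq a assms(1) in auto)
      \<comment> \<open>As \<open>\<alpha>\<^sup>2 \<noteq> 1\<close>, equal \<open>v\<close> gives
        equal \<open>s\<close>.\<close>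
      then show ?thesis
        using s sq by auto
    qed
    show "\<exists>Q. (Q, ?a) \<in> K' \<and> ?a \<in># Q \<and> (\<forall>z\<in>#Q. Re z \<le> 1)"
      unfolding K'_def using re a_in by blast
    show "\<exists>y\<in>#Q. s = ?a * y" if "(Q, s) \<in> K'" for Q s
      using that scaled unfolding K'_def by blast
    show "\<alpha>\<^sup>2 * norm s \<le> norm z" if "(Q, s) \<in> K'" "z \<in># Q" for Q s z
      using that off unfolding K'_def by blast
  qed (use assms in \<open>auto simp: K'_def size_shape sum_shape\<close>)
  let ?\<xi> = "resting_target K" and ?\<xi>' = "resting_target K'"
  have "\<not> FC_compatible n f ({?\<xi>} \<union> {?\<xi>'})" if f: "2 \<le> f" for f
  proof
    assume comp: "FC_compatible n f ({?\<xi>} \<union> {?\<xi>'})"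
    \<comment> \<open>Robots \<open>0\<close> and \<open>1\<close> crash at once, at
      \<open>1\<close> and at the negative point. Robot \<open>2\<close> runs \<open>?\<xi>\<close>
      at its resting place \<open>?a\<close>, and all later robots run \<open>?\<xi>'\<close> at
      \<open>?b\<close>, so the configuration stays \<open>?S\<close> forever.\<close>
    define p where "p i = (if i = 0 then 1 else if i = 1 then - of_real (shape_tail n \<alpha> (\<alpha>\<^sup>2))
      else if i = 2 then ?a else ?b)" for i :: nat
    define \<phi> where "\<phi> i = (if i = 2 then ?\<xi> else ?\<xi>')" for i :: nat
    define crash where "crash i = (if i < 2 then enat 0 else \<infinity>)" for i :: nat
    have idx: "{..<n} = insert 0 (insert 1 (insert 2 {3..<n}))"
      using assms(1) by auto
    have "image_mset p (mset_set {3..<n}) = image_mset (\<lambda>_. ?b) (mset_set {3..<n})"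
      by (rule image_mset_cong) (auto simp: p_def)
    then have conf: "configuration n p = ?S"
      unfolding configuration_def idx
      by (simp add: shape_def p_def image_mset_const_eq)
    have rest: "resting K ?S ?a" "resting K' ?S ?b"
      unfolding resting_def K_def K'_def
      by (intro exI[of _ ?S] exI[of _ ?a] exI[of _ ?b] exI[of _ 0] exI[of _ 1]; simp)+
    have faulty: "faulty n crash = {0, 1}"
      using assms(1) by (auto simp: faulty_def crash_def)
    have "execution n \<phi> (\<lambda>_. 1) (\<lambda>_. {..<n}) crash (\<lambda>_. p)"
      unfolding execution_def
    proof (intro allI impI)
      fix t i assume "i < n"
      have "next_position n (\<phi> i) 1 p i = p i" if "2 \<le> i"
        using rest that \<open>i < n\<close>
        by (auto simp: \<phi>_def next_position_resting_target conf p_def)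
      then show "p i = (if i \<in> {..<n} \<and> \<not> crash i \<le> enat t then next_position n (\<phi> i) 1 p i else p i)"
        by (auto simp: crash_def)
    qed
    moreover have "fair n (\<lambda>_. {..<n})"
      by (simp add: fair_def)
    ultimately have "\<exists>L. \<forall>i<n. i \<notin> faulty n crash \<longrightarrow> (\<lambda>t::nat. p i) \<longlonglongrightarrow> L"
      by (intro FC_compatibleD[OF comp, where \<phi> = \<phi> and a = "\<lambda>_. 1" and A = "\<lambda>_. {..<n}"])
        (use f in \<open>simp_all add: \<phi>_def faulty\<close>)
    then obtain L where L: "\<And>i. i < n \<Longrightarrow> i \<notin> {0, 1} \<Longrightarrow> (\<lambda>t::nat. p i) \<longlonglongrightarrow> L"
      unfolding faulty by blast
    \<comment> \<open>\<open>4 \<le> n\<close> provides robot \<open>3\<close>, so two non-faulty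
      robots at different places would share a limit.\<close>
    have "p 2 = L" "p 3 = L"
      using L[of 2] L[of 3] assms(1) by (auto simp: LIMSEQ_const_iff)
    then have "?a = ?b"
      by (simp add: p_def)
    then show False
      using sq(3) unfolding of_real_eq_iff by simp
  qed
  then show ?thesis
    using K.target_scale_resting_target K'.target_scale_resting_target
      K.FC_compatible_resting_target K'.FC_compatible_resting_target target_function_resting_target
    by blast
qed

end
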